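(* Let $T\ge 1$ be an integer, $\mu_l\in(0,1)$ and $R\ge 0$, and let the potential arrival rate satisfy $\Lambda\ge 1$. Consider the symmetric equilibrium arrival rates $\lambda^e\in[0,1)$ of the unobservable $M/M/1$ queue under the $T$-threshold service policy $(T,\mu_l,1)$ with unit delay cost rate and service reward $R$. Then: (i) If $R<1$, the unique equilibrium arrival rate is $\lambda^e=0$. (ii) If $1\le R\le \frac{1}{\mu_l}$, then $\lambda^e=0$ is an equilibrium arrival rate, and in addition there are at most two positive equilibrium arrival rates. (iii) If $R>\frac{1}{\mu_l}$, then there exist at least one and at most three positive equilibrium arrival rates.
   Context: Model. Potential customers arrive at a single-server FCFS queue according to a Poisson process with rate $\Lambda$. Service times are exponential, with rate $\mu_l$ whenever the number of customers in the system is at most $T$ and rate $\mu_h$ when it exceeds $T$, where $\mu_l<\mu_h$; it is normalized that $\mu_h=1$, and the delay cost per unit time is normalized to $C=1$. Arriving customers do not observe the queue length. Each one joins or balks; a joining customer receives reward $R$ and pays cost 1 per unit of sojourn time. If all customers join with probability $q$, the effective arrival rate is $\lambda=\Lambda q$, and the number of customers in the system is a birth-death process with birth rates $\lambda$ and death rates $\mu_n=\mu_l$ for $1\le n\le T$, $\mu_n=1$ for $n>T$; only stable rates $\lambda\in[0,1)$ are considered. Delay function. The expected stationary sojourn time for $\lambda\in[0,1)$ is $$W(\lambda)=\frac{g(\lambda)}{(1-\lambda)\,d(\lambda)},$$ $$g(\lambda)=-(T-1)(1-\mu_l)\lambda^{T}-(1-\mu_l)\sum_{j=1}^{T-1}\mu_l^{j-1}\left[(T-(j+1))\mu_l+j-1-T\right]\lambda^{T-j}+\mu_l^{T-1},$$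 $$d(\lambda)=(1-\mu_l)\sum_{j=0}^{T-1}\mu_l^{j}\lambda^{T-j}+\mu_l^{T}.$$ In particular $W(0)=1/\mu_l$. Equilibrium. The expected net benefit of a tagged customer joining with probability $p\in[0,1]$ when all others join with probability $q$ is $U(p;q)=p\,[R-W(\Lambda q)]$. A strategy $q^e\in[0,1]$ (with $\Lambda q^e<1$) is a symmetric Nash equilibrium if $U(q^e;q^e)\ge U(p;q^e)$ for all $p\in[0,1]$; then $\lambda^e=\Lambda q^e$ is called an equilibrium arrival rate (an equilibrium for short). *)

theory Defs
  imports "HOL-Analysis.Analysis"
begin

text \<open>
  Throughout, \<open>T\<close> is the threshold, \<open>\<mu>\<close> the low service rate \<open>\<mu>\<^sub>l\<close>, and the high service rate and
  the delay cost per unit time are both 1. The coefficients are computed in the reals (only the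
  exponents use subtraction on the natural numbers, where it never truncates for \<open>T \<ge> 1\<close>).
\<close>

definition delay_num :: "nat \<Rightarrow> real \<Rightarrow> real \<Rightarrow> real" where
  "delay_num T \<mu> lam =
     - (real T - 1) * (1 - \<mu>) * lam ^ T
     - (1 - \<mu>) * (\<Sum>j = 1..T - 1. \<mu> ^ (j - 1) *
         ((real T - (real j + 1)) * \<mu> + real j - 1 - real T) * lam ^ (T - j))
     + \<mu> ^ (T - 1)"

definition delay_den :: "nat \<Rightarrow> real \<Rightarrow> real \<Rightarrow> real" where
  "delay_den T \<mu> lam = (1 - \<mu>) * (\<Sum>j = 0..T - 1. \<mu> ^ j * lam ^ (T - j)) + \<mu> ^ T"

text \<open>Expected stationary sojourn time; meaningful for arrival rates \<open>0 \<le> lam < 1\<close> only.\<close>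

definition sojourn :: "nat \<Rightarrow> real \<Rightarrow> real \<Rightarrow> real" where
  "sojourn T \<mu> lam = delay_num T \<mu> lam / ((1 - lam) * delay_den T \<mu> lam)"

definition net_benefit :: "nat \<Rightarrow> real \<Rightarrow> real \<Rightarrow> real \<Rightarrow> real \<Rightarrow> real \<Rightarrow> real" where
  "net_benefit T \<mu> R \<Lambda> p q = p * (R - sojourn T \<mu> (\<Lambda> * q))"

definition symmetric_nash :: "nat \<Rightarrow> real \<Rightarrow> real \<Rightarrow> real \<Rightarrow> real \<Rightarrow> bool" where
  "symmetric_nash T \<mu> R \<Lambda> q \<longleftrightarrow>
     q \<in> {0..1} \<and> \<Lambda> * q < 1 \<and>
     (\<forall>p \<in> {0..1}. net_benefit T \<mu> R \<Lambda> q q \<ge> net_benefit T \<mu> R \<Lambda> p q)"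

definition equilibrium_rate :: "nat \<Rightarrow> real \<Rightarrow> real \<Rightarrow> real \<Rightarrow> real \<Rightarrow> bool" where
  "equilibrium_rate T \<mu> R \<Lambda> lam \<longleftrightarrow> (\<exists>q. symmetric_nash T \<mu> R \<Lambda> q \<and> lam = \<Lambda> * q)"

definition service_rate :: "nat \<Rightarrow> real \<Rightarrow> nat \<Rightarrow> real" where
  "service_rate T \<mu> n = (if n \<le> T then \<mu> else 1)"

text \<open>
  The detailed balance equations give the stationary distribution as the normalised product of the
  ratios of birth rate to death rate.
\<close>

definition bd_weight :: "nat \<Rightarrow> real \<Rightarrow> real \<Rightarrow> nat \<Rightarrow> real" where
  "bd_weight T \<mu> lam n = (\<Prod>k = 1..n. lam / service_rate T \<mu> k)"

definition bd_stationary :: "nat \<Rightarrow> real \<Rightarrow> real \<Rightarrow> nat \<Rightarrow> real" where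
  "bd_stationary T \<mu> lam n = bd_weight T \<mu> lam n / (\<Sum>m. bd_weight T \<mu> lam m)"

lemma bd_weight_low: "n \<le> T \<Longrightarrow> bd_weight T \<mu> lam n = (lam / \<mu>) ^ n"
  by (simp add: bd_weight_def service_rate_def)

lemma bd_weight_high: "bd_weight T \<mu> lam (T + k) = (lam / \<mu>) ^ T * lam ^ k"
proof (induction k)
  case 0
  then show ?case by (simp add: bd_weight_low)
next
  case (Suc k)
  have "bd_weight T \<mu> lam (T + Suc k) = bd_weight T \<mu> lam (T + k) * lam"
    by (simp add: bd_weight_def service_rate_def)
  with Suc show ?case by simp
qed

lemma sum_low_Suc:
  fixes c :: "nat \<Rightarrow> real" and \<mu> lam :: real
  shows "(\<Sum>n\<le>Suc T. c n * lam ^ n * \<mu> ^ (Suc T - n)) =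
    \<mu> * (\<Sum>n\<le>T. c n * lam ^ n * \<mu> ^ (T - n)) + c (Suc T) * lam ^ Suc T"
proof -
  have "(\<Sum>n\<le>T. c n * lam ^ n * \<mu> ^ (Suc T - n)) = (\<Sum>n\<le>T. \<mu> * (c n * lam ^ n * \<mu> ^ (T - n)))"
    by (rule sum.cong) (auto simp: Suc_diff_le)
  then show ?thesis by (simp add: sum_distrib_left)
qed

lemma delay_den_Suc:
  assumes "T \<ge> 1"
  shows "delay_den (Suc T) \<mu> lam = \<mu> * delay_den T \<mu> lam + (1 - \<mu>) * lam ^ Suc T"
proof -
  obtain S where S: "T = Suc S" using assms by (cases T) auto
  have "(\<Sum>j = 0..Suc S. \<mu> ^ j * lam ^ (Suc T - j)) =
      lam ^ Suc T + (\<Sum>j = 0..S. \<mu> ^ Suc j * lam ^ (T - j))"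
    by (subst sum.atLeast0_atMost_Suc_shift) (simp add: S)
  also have "(\<Sum>j = 0..S. \<mu> ^ Suc j * lam ^ (T - j)) = \<mu> * (\<Sum>j = 0..S. \<mu> ^ j * lam ^ (T - j))"
    by (simp add: sum_distrib_left mult.assoc)
  finally have *: "(\<Sum>j = 0..Suc S. \<mu> ^ j * lam ^ (Suc T - j)) =
      lam ^ Suc T + \<mu> * (\<Sum>j = 0..S. \<mu> ^ j * lam ^ (T - j))" .
  have 1: "delay_den (Suc T) \<mu> lam =
      (1 - \<mu>) * (\<Sum>j = 0..Suc S. \<mu> ^ j * lam ^ (Suc T - j)) + \<mu> ^ Suc T"
    by (simp add: delay_den_def S)
  have 2: "delay_den T \<mu> lam = (1 - \<mu>) * (\<Sum>j = 0..S. \<mu> ^ j * lam ^ (T - j)) + \<mu> ^ T"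
    by (simp add: delay_den_def S)
  show ?thesis unfolding 1 2 * by (simp add: algebra_simps)
qed

lemma delay_num_Suc:
  assumes "T \<ge> 1"
  shows "delay_num (Suc T) \<mu> lam =
    \<mu> * (delay_num T \<mu> lam + (real T - 1) * (1 - \<mu>) * lam ^ T)
      - real T * (1 - \<mu>) * lam ^ Suc T - (1 - \<mu>) * ((real T - 1) * \<mu> - real T - 1) * lam ^ T"
proof -
  define f where "f T j = \<mu> ^ (j - 1) * ((real T - (real j + 1)) * \<mu> + real j - 1 - real T)
    * lam ^ (T - j)" for T j :: nat
  obtain S where S: "T = Suc S" using assms by (cases T) auto
  have "(\<Sum>j = 1..Suc S. f (Suc T) j) = f (Suc T) 1 + (\<Sum>j = Suc 1..Suc S. f (Suc T) j)"
    by (rule sum.atLeast_Suc_atMost) simp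
  also have "(\<Sum>j = Suc 1..Suc S. f (Suc T) j) = (\<Sum>j = 1..S. f (Suc T) (Suc j))"
    by (rule sum.shift_bounds_cl_Suc_ivl)
  also have "\<dots> = (\<Sum>j = 1..S. \<mu> * f T j)"
  proof (rule sum.cong)
    fix j assume "j \<in> {1..S}"
    then obtain i where "j = Suc i" by (cases j) auto
    then show "f (Suc T) (Suc j) = \<mu> * f T j" by (simp add: f_def)
  qed simp
  finally have *: "(\<Sum>j = 1..Suc S. f (Suc T) j) = f (Suc T) 1 + \<mu> * (\<Sum>j = 1..S. f T j)"
    by (simp add: sum_distrib_left)
  have 1: "delay_num (Suc T) \<mu> lam = - real T * (1 - \<mu>) * lam ^ Suc T
      - (1 - \<mu>) * (\<Sum>j = 1..Suc S. f (Suc T) j) + \<mu> ^ T"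
    unfolding delay_num_def f_def using S by simp
  have 2: "delay_num T \<mu> lam = - (real T - 1) * (1 - \<mu>) * lam ^ T
      - (1 - \<mu>) * (\<Sum>j = 1..S. f T j) + \<mu> ^ S"
    unfolding delay_num_def f_def using S by simp
  have 3: "f (Suc T) 1 = ((real T - 1) * \<mu> - real T - 1) * lam ^ T"
    by (simp add: f_def)
  show ?thesis unfolding 1 2 * 3 by (simp add: S algebra_simps)
qed

lemma delay_den_eq:
  assumes "T \<ge> 1"
  shows "delay_den T \<mu> lam = (1 - lam) * (\<Sum>n\<le>T. lam ^ n * \<mu> ^ (T - n)) + lam ^ Suc T"
  using assms
proof (induction T rule: dec_induct)
  case base
  show ?case by (simp add: delay_den_def algebra_simps)
next
  case (step T)
  have A: "(\<Sum>n\<le>Suc T. lam ^ n * \<mu> ^ (Suc T - n)) = \<mu> * (\<Sum>n\<le>T. lam ^ n * \<mu> ^ (T - n)) + lam ^ Suc T"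
    using sum_low_Suc[of "\<lambda>_. 1" lam \<mu> T] by simp
  show ?case
    unfolding delay_den_Suc[OF step(1)] A step.IH by (simp add: algebra_simps)
qed

lemma delay_num_eq:
  assumes "T \<ge> 1"
  shows "lam * delay_num T \<mu> lam =
    (1 - lam)\<^sup>2 * (\<Sum>n\<le>T. real n * lam ^ n * \<mu> ^ (T - n)) + lam ^ Suc T * (real T * (1 - lam) + 1)"
  using assms
proof (induction T rule: dec_induct)
  case base
  show ?case by (simp add: delay_num_def algebra_simps power2_eq_square)
next
  case (step T)
  have N: "lam * delay_num (Suc T) \<mu> lam =
    \<mu> * (lam * delay_num T \<mu> lam) + \<mu> * (real T - 1) * (1 - \<mu>) * lam ^ Suc T
      - real T * (1 - \<mu>) * lam ^ Suc (Suc T) - (1 - \<mu>) * ((real T - 1) * \<mu> - real T - 1) * lam ^ Suc T"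
    unfolding delay_num_Suc[OF step(1)] by (simp add: algebra_simps)
  show ?case
    unfolding N sum_low_Suc step.IH by (simp add: algebra_simps power2_eq_square)
qed

text \<open>
  Little's law: the stationary mean number in the system is the arrival rate times the sojourn time.
\<close>

theorem sojourn_little:
  assumes T: "T \<ge> 1" and \<mu>: "0 < \<mu>" "\<mu> < 1" and lam: "0 \<le> lam" "lam < 1"
  shows "bd_stationary T \<mu> lam sums 1"
    and "(\<lambda>n. real n * bd_stationary T \<mu> lam n) sums (lam * sojourn T \<mu> lam)"
proof -
  let ?w = "bd_weight T \<mu> lam"
  define A where "A = (\<Sum>n\<le>T. lam ^ n * \<mu> ^ (T - n))"
  define B where "B = (\<Sum>n\<le>T. real n * lam ^ n * \<mu> ^ (T - n))"
  have low: "?w n = lam ^ n * \<mu> ^ (T - n) / \<mu> ^ T" if "n \<le> T" for n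
  proof -
    have "\<mu> ^ T = \<mu> ^ n * \<mu> ^ (T - n)" using that by (simp flip: power_add)
    then show ?thesis using \<mu> by (simp add: bd_weight_low that power_divide)
  qed
  have high: "?w (k + Suc T) = lam ^ Suc T / \<mu> ^ T * lam ^ k" for k
    using bd_weight_high[of T \<mu> lam "Suc k"] by (simp add: power_divide add.commute)
  have geo: "(\<lambda>k. lam ^ k) sums (1 / (1 - lam))"
    using lam by (intro geometric_sums) simp
  have "(\<lambda>k. of_nat (Suc k) * lam ^ k) sums (1 / (1 - lam)\<^sup>2)"
    using lam by (intro geometric_deriv_sums) simp
  then have dgeo: "(\<lambda>k. real (Suc k) * lam ^ k) sums (1 / (1 - lam)\<^sup>2)" by simp
  have sA: "(\<Sum>n<Suc T. ?w n) = A / \<mu> ^ T"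
    unfolding A_def lessThan_Suc_atMost sum_divide_distrib by (rule sum.cong) (simp_all add: low)
  have sB: "(\<Sum>n<Suc T. real n * ?w n) = B / \<mu> ^ T"
    unfolding B_def lessThan_Suc_atMost sum_divide_distrib by (rule sum.cong) (simp_all add: low)
  have "(\<lambda>k. ?w (k + Suc T)) sums (lam ^ Suc T / \<mu> ^ T * (1 / (1 - lam)))"
    unfolding high by (rule sums_mult[OF geo])
  then have W0: "?w sums (lam ^ Suc T / \<mu> ^ T * (1 / (1 - lam)) + A / \<mu> ^ T)"
    unfolding sums_iff_shift sA[symmetric] by simp
  have tot: "lam ^ Suc T / \<mu> ^ T * (1 / (1 - lam)) + A / \<mu> ^ T = delay_den T \<mu> lam / (\<mu> ^ T * (1 - lam))"
    unfolding delay_den_eq[OF T] A_def[symmetric] using \<mu> lam by (simp add: field_simps)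
  have D: "delay_den T \<mu> lam > 0"
    unfolding delay_den_def using \<mu> lam
    by (intro add_nonneg_pos mult_nonneg_nonneg sum_nonneg) auto
  have W1: "?w sums (delay_den T \<mu> lam / (\<mu> ^ T * (1 - lam)))" using W0 unfolding tot .
  have tot1: "suminf ?w = delay_den T \<mu> lam / (\<mu> ^ T * (1 - lam))" using W1 by (rule sums_unique[symmetric])
  have nz: "suminf ?w \<noteq> 0" unfolding tot1 using D \<mu> lam by simp
  show "bd_stationary T \<mu> lam sums 1"
    using sums_divide[OF W1, of "suminf ?w"] nz unfolding bd_stationary_def tot1[symmetric] by simp
  have "(\<lambda>k. lam ^ Suc T / \<mu> ^ T * (real T * lam ^ k + real (Suc k) * lam ^ k)) sums
      (lam ^ Suc T / \<mu> ^ T * (real T * (1 / (1 - lam)) + 1 / (1 - lam)\<^sup>2))"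
    by (intro sums_mult sums_add geo dgeo)
  moreover have "real (k + Suc T) * ?w (k + Suc T) =
      lam ^ Suc T / \<mu> ^ T * (real T * lam ^ k + real (Suc k) * lam ^ k)" for k
    unfolding high by (simp add: field_simps)
  ultimately have "(\<lambda>k. real (k + Suc T) * ?w (k + Suc T)) sums
      (lam ^ Suc T / \<mu> ^ T * (real T * (1 / (1 - lam)) + 1 / (1 - lam)\<^sup>2))"
    by (simp only:)
  then have M0: "(\<lambda>n. real n * ?w n) sums
      (lam ^ Suc T / \<mu> ^ T * (real T * (1 / (1 - lam)) + 1 / (1 - lam)\<^sup>2) + B / \<mu> ^ T)"
    unfolding sB[symmetric] by (subst (asm) sums_iff_shift)
  have nz1: "1 - lam \<noteq> 0" "\<mu> ^ T \<noteq> 0" using \<mu> lam by auto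
  have alg: "x / m * (t * (1 / y) + 1 / y\<^sup>2) + b / m = (y\<^sup>2 * b + x * (t * y + 1)) / (m * y\<^sup>2)"
    if "y \<noteq> 0" "m \<noteq> 0" for x m t y b :: real
    using that by (simp add: field_simps power2_eq_square)
  have alg2: "l * n / (m * y\<^sup>2) / (d / (m * y)) = l * (n / (y * d))"
    if "y \<noteq> 0" "m \<noteq> 0" "d \<noteq> 0" for l n m y d :: real
    using that by (simp add: power2_eq_square)
  have M1: "(\<lambda>n. real n * ?w n) sums (lam * delay_num T \<mu> lam / (\<mu> ^ T * (1 - lam)\<^sup>2))"
    using M0 unfolding alg[OF nz1] delay_num_eq[OF T] B_def .
  have "(\<lambda>n. real n * ?w n / suminf ?w) sums
      (lam * delay_num T \<mu> lam / (\<mu> ^ T * (1 - lam)\<^sup>2) / suminf ?w)"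
    by (rule sums_divide[OF M1])
  moreover have "lam * delay_num T \<mu> lam / (\<mu> ^ T * (1 - lam)\<^sup>2) / suminf ?w = lam * sojourn T \<mu> lam"
    unfolding tot1 sojourn_def using alg2[OF nz1] D by simp
  ultimately show "(\<lambda>n. real n * bd_stationary T \<mu> lam n) sums (lam * sojourn T \<mu> lam)"
    unfolding bd_stationary_def by simp
qed

lemma sojourn_0:
  assumes "T \<ge> 1" "0 < \<mu>"
  shows "sojourn T \<mu> 0 = 1 / \<mu>"
proof -
  obtain S where S: "T = Suc S" using assms by (cases T) auto
  have "(\<Sum>j = 0..S. \<mu> ^ j * 0 ^ (Suc S - j)) = 0" by (intro sum.neutral) auto
  then have "delay_den T \<mu> 0 = \<mu> ^ T" by (simp add: delay_den_def S)
  moreover have "(\<Sum>j = 1..S. \<mu> ^ (j - 1) *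
      ((real T - (real j + 1)) * \<mu> + real j - 1 - real T) * 0 ^ (T - j)) = 0"
    by (intro sum.neutral) (auto simp: S)
  then have "delay_num T \<mu> 0 = \<mu> ^ S" unfolding delay_num_def by (simp add: S)
  ultimately show ?thesis using assms by (simp add: sojourn_def S)
qed

end

theory Submission
  imports Defs
begin

text \<open>
  Since \<open>\<Lambda> \<ge> 1\<close> and only rates below 1 are admitted, a positive equilibrium never has everybody
  joining. Its joining probability is interior, so a customer must be indifferent, and the positive
  equilibrium rates are the solutions of \<open>sojourn T \<mu> x = R\<close> in \<open>(0, 1)\<close>. The rate 0 is an equilibrium
  exactly when \<open>R \<le> sojourn T \<mu> 0 = 1 / \<mu>\<close>. Everything else is a count of zeros.

  Write \<open>N\<close> and \<open>D\<close> for the numerator and denominator polynomials of the delay function. The sign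
  pattern of the polynomial \<open>N - R (1 - x) D\<close> can have too many changes for Descartes' rule to give
  the bound in the case \<open>R > 1 / \<mu>\<close> (for \<open>\<mu>\<close> near \<open>1 / 2\<close> the coefficient of \<open>x\<close> may spoil it).
  Dividing by \<open>1 - x\<close>, which does not change the zeros in \<open>(0, 1)\<close>, repairs this: the coefficients of the power series
  \<open>N / (1 - x) - R D\<close> are partial sums of the old ones and have a simple closed form. Let \<open>a\<^sub>k\<close> be
  these coefficients. Then \<open>a\<^sub>0\<close> has the sign of \<open>1 / \<mu> - R\<close>. For \<open>1 \<le> k < T\<close>, \<open>a\<^sub>k\<close> is a positive
  multiple of an increasing affine function of \<open>k\<close>, which is positive if \<open>R \<le> 1 / \<mu>\<close>. The single
  coefficient \<open>a\<^sub>T = 1 - R (1 - \<mu>)\<close> may have either sign, and \<open>a\<^sub>k = 1\<close> for \<open>k > T\<close>.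

  Thus there is no sign change if \<open>R < 1\<close>. If \<open>R \<le> 1 / \<mu>\<close>, there are at most two, around the index
  \<open>T\<close>. If \<open>R > 1 / \<mu>\<close>, there is at most one more, where the affine function changes sign. The bounds
  0, 2 and 3 follow from Descartes' rule for power series on \<open>(0, 1)\<close>
  (\<open>card_zeros_power_series_le\<close>), which rests on Rolle's theorem.
  Existence for \<open>R > 1 / \<mu>\<close> is the intermediate value theorem: \<open>N - R (1 - x) D\<close> is negative at 0
  and equals 1 at 1.
\<close>

section \<open>Counting zeros of power series\<close>

text \<open>
  Rolle's theorem between consecutive points of a finite set of zeros. Points are added in increasing
  order; that every zero of \<open>F'\<close> collected so far lies below some point of \<open>Z\<close> guarantees that the
  next one, found beyond \<open>Max Z\<close>, is new.
\<close>

lemma finite_zeros_card_le_deriv_zeros: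
  fixes F F' :: "real \<Rightarrow> real" and l u :: real
  assumes der: "\<And>x. l < x \<Longrightarrow> x < u \<Longrightarrow> (F has_real_derivative F' x) (at x)"
    and Z: "finite Z" "Z \<subseteq> {x. l < x \<and> x < u \<and> F x = 0}"
  shows "\<exists>D. finite D \<and> D \<subseteq> {x. l < x \<and> x < u \<and> F' x = 0} \<and> (\<forall>d\<in>D. \<exists>z\<in>Z. d < z) \<and>
    card Z \<le> Suc (card D)"
  using Z
proof (induction Z rule: finite_linorder_max_induct)
  case empty
  then show ?case by (intro exI[of _ "{}"]) auto
next
  case (insert b Z)
  then obtain D where D: "finite D" "D \<subseteq> {x. l < x \<and> x < u \<and> F' x = 0}"
      "\<forall>d\<in>D. \<exists>z\<in>Z. d < z" "card Z \<le> Suc (card D)"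
    by auto
  show ?case
  proof (cases "Z = {}")
    case True
    then show ?thesis by (intro exI[of _ "{}"]) auto
  next
    case False
    define m where "m = Max Z"
    have m: "m \<in> Z" "\<And>z. z \<in> Z \<Longrightarrow> z \<le> m"
      using False insert.hyps(1) by (auto simp: m_def)
    have mb: "m < b" "l < m" "b < u" "F m = F b"
      using m(1) insert.hyps(2) insert.prems by auto
    have "\<exists>d. m < d \<and> d < b \<and> F' d = 0"
    proof -
      have "\<exists>d>m. d < b \<and> (\<lambda>h. h * F' d) = (\<lambda>v. 0)"
      proof (rule Rolle_deriv)
        show "continuous_on {m..b} F"
          using mb by (intro continuous_at_imp_continuous_on ballI DERIV_isCont[OF der]) auto
        show "(F has_derivative (\<lambda>h. h * F' x)) (at x)" if "m < x" "x < b" for x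
          using der[of x] that mb by (simp add: has_field_derivative_def mult_commute_abs)
      qed (use mb in auto)
      then show ?thesis by (metis mult_1)
    qed
    then obtain d where d: "m < d" "d < b" "F' d = 0" by blast
    have "d \<notin> D" using D(3) m(2) d(1) by fastforce
    then have "card (insert d D) = Suc (card D)" using D(1) by simp
    moreover have "card (insert b Z) = Suc (card Z)" using insert.hyps by auto
    ultimately show ?thesis
      using D d mb insert.hyps(2) by (intro exI[of _ "insert d D"]) (auto intro: less_trans)
  qed
qed

lemma card_zeros_le_Suc_card_deriv_zeros:
  fixes F F' :: "real \<Rightarrow> real" and l u :: real
  assumes der: "\<And>x. l < x \<Longrightarrow> x < u \<Longrightarrow> (F has_real_derivative F' x) (at x)"
    and fin: "finite {x. l < x \<and> x < u \<and> F' x = 0}"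
    and card: "card {x. l < x \<and> x < u \<and> F' x = 0} \<le> n"
  shows "finite {x. l < x \<and> x < u \<and> F x = 0} \<and> card {x. l < x \<and> x < u \<and> F x = 0} \<le> Suc n"
proof (rule finite_if_finite_subsets_card_bdd)
  fix G assume "G \<subseteq> {x. l < x \<and> x < u \<and> F x = 0}" "finite G"
  then obtain D where "D \<subseteq> {x. l < x \<and> x < u \<and> F' x = 0}" "card G \<le> Suc (card D)"
    using finite_zeros_card_le_deriv_zeros[OF der, of l u G] by auto
  moreover have "card D \<le> n"
    using card_mono[OF fin \<open>D \<subseteq> _\<close>] card by (rule le_trans)
  ultimately show "card G \<le> Suc n" by linarith
qed

text \<open>
  Descartes' rule of signs in a form that needs no counting of sign changes: the change positions are
  supplied as real nodes \<open>ss\<close>, and the product of the factors \<open>k - s\<close> has to follow the sign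
  of \<open>a k\<close>. Multiplying the coefficients by \<open>k - s\<close> turns \<open>f x\<close> into \<open>x * f' x - s * f x\<close>, which up to
  a power of \<open>x\<close> is the derivative of \<open>x powr (- s) * f x\<close>. So by Rolle each node costs at most one
  zero, and once all nodes are used up a series with nonnegative coefficients remains, which is
  positive. A node placed exactly on an index removes any condition on that coefficient.
\<close>

theorem card_zeros_power_series_le:
  fixes a :: "nat \<Rightarrow> real" and ss :: "real list"
  assumes "\<And>x. 0 < x \<Longrightarrow> x < 1 \<Longrightarrow> summable (\<lambda>k. a k * x ^ k)"
    and "\<And>k. 0 \<le> (\<Prod>s\<leftarrow>ss. real k - s) * a k"
    and "0 < (\<Prod>s\<leftarrow>ss. real m - s) * a m"
  shows "finite {x. 0 < x \<and> x < 1 \<and> (\<Sum>k. a k * x ^ k) = 0} \<and>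
    card {x. 0 < x \<and> x < 1 \<and> (\<Sum>k. a k * x ^ k) = 0} \<le> length ss"
  using assms
proof (induction ss arbitrary: a)
  case Nil
  have "(\<Sum>k. a k * x ^ k) > 0" if "0 < x" "x < 1" for x
    using Nil that by (intro suminf_pos2[where i = m]) auto
  then have "{x. 0 < x \<and> x < 1 \<and> (\<Sum>k. a k * x ^ k) = 0} = {}" by force
  then show ?case by (metis card.empty finite.emptyI le0)
next
  case (Cons s ss)
  define f where "f x = (\<Sum>k. a k * x ^ k)" for x
  define f' where "f' x = (\<Sum>k. diffs a k * x ^ k)" for x
  define b where "b k = (real k - s) * a k" for k
  \<comment> \<open>The series converges on all of \<open>(-1, 1)\<close>, so it may be differentiated termwise.\<close>
  have der: "(f has_real_derivative f' x) (at x)" and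
    b_sums: "(\<lambda>k. b k * x ^ k) sums (x * f' x - s * f x)" if x: "0 < x" "x < 1" for x
  proof -
    obtain K where K: "x < K" "K < 1" using dense[OF x(2)] by blast
    have sK: "summable (\<lambda>k. a k * K ^ k)" using Cons.prems(1)[of K] K x by simp
    show "(f has_real_derivative f' x) (at x)"
      unfolding f_def f'_def using sK by (rule termdiffs_strong) (use x K in simp)
    have "summable (\<lambda>k. diffs a k * x ^ k)"
    proof (rule termdiff_converges[where K = 1])
      show "summable (\<lambda>k. a k * y ^ k)" if "norm y < 1" for y
      proof (rule powser_inside[where x = "(\<bar>y\<bar> + 1) / 2"])
        show "summable (\<lambda>k. a k * ((\<bar>y\<bar> + 1) / 2) ^ k)"
          using that by (intro Cons.prems(1)) auto
      qed (use that in auto)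
    qed (use x in auto)
    from sums_mult[OF diffs_equiv[OF this], of x]
    have "(\<lambda>k. x * (real k * a k * x ^ (k - Suc 0))) sums (x * f' x)"
      by (simp add: f'_def)
    moreover have "x * (real k * a k * x ^ (k - Suc 0)) = real k * a k * x ^ k" for k
      by (cases k) auto
    ultimately have "(\<lambda>k. real k * a k * x ^ k) sums (x * f' x)" by simp
    moreover have "(\<lambda>k. s * (a k * x ^ k)) sums (s * f x)"
      unfolding f_def using Cons.prems(1)[OF x] by (intro sums_mult summable_sums)
    ultimately have "(\<lambda>k. real k * a k * x ^ k - s * (a k * x ^ k)) sums (x * f' x - s * f x)"
      by (rule sums_diff)
    then show "(\<lambda>k. b k * x ^ k) sums (x * f' x - s * f x)"
      by (simp add: b_def algebra_simps)
  qed
  let ?g = "\<lambda>x. (\<Sum>k. b k * x ^ k)"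
  have IH: "finite {x. 0 < x \<and> x < 1 \<and> ?g x = 0} \<and> card {x. 0 < x \<and> x < 1 \<and> ?g x = 0} \<le> length ss"
  proof (rule Cons.IH)
    show "summable (\<lambda>k. b k * x ^ k)" if "0 < x" "x < 1" for x
      using b_sums[OF that] by (rule sums_summable)
    show "0 \<le> (\<Prod>s\<leftarrow>ss. real k - s) * b k" for k
      using Cons.prems(2)[of k] by (simp add: b_def mult_ac)
    show "0 < (\<Prod>s\<leftarrow>ss. real m - s) * b m"
      using Cons.prems(3) by (simp add: b_def mult_ac)
  qed
  define F' where "F' x = x powr (- s - 1) * (x * f' x - s * f x)" for x
  have dF: "((\<lambda>x. x powr (- s) * f x) has_real_derivative F' x) (at x)"
    if x: "0 < x" "x < 1" for x
  proof -
    have "((\<lambda>x. x powr (- s) * f x) has_real_derivative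
        - s * x powr (- s - 1) * f x + f' x * x powr (- s)) (at x)"
      by (rule DERIV_mult[OF has_real_derivative_powr[OF x(1)] der[OF x]])
    moreover have "x powr (- s) = x * x powr (- s - 1)"
      using x by (simp add: powr_mult_base)
    ultimately show ?thesis by (simp add: F'_def algebra_simps)
  qed
  have "{x. 0 < x \<and> x < 1 \<and> F' x = 0} = {x. 0 < x \<and> x < 1 \<and> ?g x = 0}"
    using sums_unique[OF b_sums] by (intro Collect_cong conj_cong refl) (simp add: F'_def)
  with IH have "finite {x. 0 < x \<and> x < 1 \<and> x powr (- s) * f x = 0} \<and>
      card {x. 0 < x \<and> x < 1 \<and> x powr (- s) * f x = 0} \<le> Suc (length ss)"
    by (intro card_zeros_le_Suc_card_deriv_zeros[OF dF]) auto
  moreover have "{x. 0 < x \<and> x < 1 \<and> x powr (- s) * f x = 0} = {x. 0 < x \<and> x < 1 \<and> f x = 0}"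
    by auto
  ultimately show ?case by (simp add: f_def)
qed

section \<open>The delay function as a quotient of power series\<close>

text \<open>
  Coefficients of \<open>delay_num T \<mu> x / (1 - x)\<close>, that is, partial sums of those of the numerator. From
  index \<open>T\<close> on they equal the value 1 of the numerator at \<open>x = 1\<close>.
\<close>

definition num_coeff :: "nat \<Rightarrow> real \<Rightarrow> nat \<Rightarrow> real" where
  "num_coeff T \<mu> k = (if k < T then \<mu> ^ (T - 1 - k) * (real k + 1 - real k * \<mu>) else 1)"

definition den_coeff :: "nat \<Rightarrow> real \<Rightarrow> nat \<Rightarrow> real" where
  "den_coeff T \<mu> k =
    (if k = 0 then \<mu> ^ T else if k \<le> T then (1 - \<mu>) * \<mu> ^ (T - k) else 0)"

definition excess_coeff :: "nat \<Rightarrow> real \<Rightarrow> real \<Rightarrow> nat \<Rightarrow> real" where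
  "excess_coeff T \<mu> R k = num_coeff T \<mu> k - R * den_coeff T \<mu> k"

lemma delay_num_eq_sum:
  assumes "T \<ge> 1"
  shows "delay_num T \<mu> x = (1 - x) * (\<Sum>k<T. num_coeff T \<mu> k * x ^ k) + x ^ T"
  using assms
proof (induction T rule: dec_induct)
  case base
  show ?case by (simp add: delay_num_def num_coeff_def)
next
  case (step T)
  have "(\<Sum>k<T. num_coeff (Suc T) \<mu> k * x ^ k) = (\<Sum>k<T. \<mu> * (num_coeff T \<mu> k * x ^ k))"
  proof (rule sum.cong)
    fix k assume "k \<in> {..<T}"
    then have "T - k = Suc (T - 1 - k)" by auto
    with \<open>k \<in> {..<T}\<close> show "num_coeff (Suc T) \<mu> k * x ^ k = \<mu> * (num_coeff T \<mu> k * x ^ k)"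
      by (simp add: num_coeff_def)
  qed simp
  then have S: "(\<Sum>k<Suc T. num_coeff (Suc T) \<mu> k * x ^ k) =
      \<mu> * (\<Sum>k<T. num_coeff T \<mu> k * x ^ k) + (real T + 1 - real T * \<mu>) * x ^ T"
    by (simp add: sum_distrib_left num_coeff_def)
  show ?case
    unfolding delay_num_Suc[OF step(1)] step.IH S by (simp add: algebra_simps)
qed

lemma delay_den_eq_sum:
  assumes "T \<ge> 1"
  shows "delay_den T \<mu> x = (\<Sum>k\<le>T. den_coeff T \<mu> k * x ^ k)"
  using assms
proof (induction T rule: dec_induct)
  case base
  show ?case by (simp add: delay_den_def den_coeff_def)
next
  case (step T)
  have "(\<Sum>k\<le>T. den_coeff (Suc T) \<mu> k * x ^ k) = (\<Sum>k\<le>T. \<mu> * (den_coeff T \<mu> k * x ^ k))"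
    by (rule sum.cong) (auto simp: den_coeff_def Suc_diff_le)
  then show ?case
    unfolding delay_den_Suc[OF step(1)] step.IH by (simp add: sum_distrib_left den_coeff_def)
qed

lemma delay_den_pos:
  assumes "0 < \<mu>" "\<mu> < 1" "0 \<le> x"
  shows "delay_den T \<mu> x > 0"
  unfolding delay_den_def using assms
  by (intro add_nonneg_pos mult_nonneg_nonneg sum_nonneg) auto

lemma excess_coeff_sums:
  assumes T: "T \<ge> 1" and x: "0 \<le> x" "x < 1"
  shows "(\<lambda>k. excess_coeff T \<mu> R k * x ^ k) sums
    (delay_num T \<mu> x / (1 - x) - R * delay_den T \<mu> x)"
proof -
  have "(\<lambda>k. x ^ T * x ^ k) sums (x ^ T * (1 / (1 - x)))"
    using x by (intro sums_mult geometric_sums) simp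
  then have "(\<lambda>k. num_coeff T \<mu> (k + T) * x ^ (k + T)) sums (x ^ T * (1 / (1 - x)))"
    by (simp add: num_coeff_def power_add mult.commute)
  then have "(\<lambda>k. num_coeff T \<mu> k * x ^ k) sums
      (x ^ T * (1 / (1 - x)) + (\<Sum>k<T. num_coeff T \<mu> k * x ^ k))"
    by (subst (asm) sums_iff_shift)
  moreover have "x ^ T * (1 / (1 - x)) + (\<Sum>k<T. num_coeff T \<mu> k * x ^ k) = delay_num T \<mu> x / (1 - x)"
    using x by (simp add: delay_num_eq_sum[OF T] field_simps)
  ultimately have num: "(\<lambda>k. num_coeff T \<mu> k * x ^ k) sums (delay_num T \<mu> x / (1 - x))" by simp
  have "(\<lambda>k. den_coeff T \<mu> k * x ^ k) sums (\<Sum>k\<le>T. den_coeff T \<mu> k * x ^ k)"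
    using T by (intro sums_finite) (auto simp: den_coeff_def)
  then have den: "(\<lambda>k. den_coeff T \<mu> k * x ^ k) sums delay_den T \<mu> x"
    by (simp add: delay_den_eq_sum[OF T])
  show ?thesis
    using sums_diff[OF num sums_mult[OF den, of R]]
    by (simp add: excess_coeff_def algebra_simps)
qed

text \<open>
  The excess series is the difference \<open>sojourn T \<mu> x - R\<close> multiplied by \<open>delay_den T \<mu> x > 0\<close>.
\<close>

lemma sojourn_eq_iff_excess_zero:
  assumes "T \<ge> 1" "0 < \<mu>" "\<mu> < 1" "0 \<le> x" "x < 1"
  shows "sojourn T \<mu> x = R \<longleftrightarrow> (\<Sum>k. excess_coeff T \<mu> R k * x ^ k) = 0"
proof -
  have "(\<Sum>k. excess_coeff T \<mu> R k * x ^ k) = delay_num T \<mu> x / (1 - x) - R * delay_den T \<mu> x"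
    using excess_coeff_sums[of T x \<mu> R] assms by (simp add: sums_iff)
  moreover have "n / ((1 - x) * d) = R \<longleftrightarrow> n / (1 - x) - R * d = 0" if "0 < d" for n d
    using that assms(5) by (simp add: field_simps)
  ultimately show ?thesis
    using delay_den_pos[OF assms(2-4), of T] by (simp add: sojourn_def)
qed

section \<open>Signs of the coefficients\<close>

lemma excess_coeff_0: "T \<ge> 1 \<Longrightarrow> excess_coeff T \<mu> R 0 = \<mu> ^ (T - 1) * (1 - R * \<mu>)"
  by (cases T) (auto simp: excess_coeff_def num_coeff_def den_coeff_def algebra_simps)

lemma excess_coeff_low:
  assumes "1 \<le> k" "k < T"
  shows "excess_coeff T \<mu> R k = \<mu> ^ (T - 1 - k) * ((1 - \<mu>) * (real k - R * \<mu>) + 1)"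
proof -
  have "\<mu> ^ (T - k) = \<mu> * \<mu> ^ (T - 1 - k)"
    using assms by (metis Suc_diff_Suc diff_Suc_eq_diff_pred power_Suc)
  then show ?thesis
    using assms by (simp add: excess_coeff_def num_coeff_def den_coeff_def algebra_simps)
qed

lemma excess_coeff_T: "T \<ge> 1 \<Longrightarrow> excess_coeff T \<mu> R T = 1 - R * (1 - \<mu>)"
  by (simp add: excess_coeff_def num_coeff_def den_coeff_def)

lemma excess_coeff_high: "T < k \<Longrightarrow> excess_coeff T \<mu> R k = 1"
  by (simp add: excess_coeff_def num_coeff_def den_coeff_def)

text \<open>
  If the reward does not exceed the delay \<open>1 / \<mu>\<close> of the empty system, the index \<open>T\<close>, where the
  service rate switches, is the only place where a negative coefficient can occur.
\<close>

lemma excess_coeff_nonneg: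
  assumes "T \<ge> 1" "0 < \<mu>" "\<mu> < 1" "R * \<mu> \<le> 1" "k \<noteq> T"
  shows "0 \<le> excess_coeff T \<mu> R k"
proof -
  consider "k = 0" | "1 \<le> k" "k < T" | "T < k" using assms(5) by linarith
  then show ?thesis
  proof cases
    case 2
    then have "0 \<le> (1 - \<mu>) * (real k - R * \<mu>)"
      using assms by (intro mult_nonneg_nonneg) auto
    then show ?thesis using 2 assms by (simp add: excess_coeff_low)
  qed (use assms in \<open>auto simp: excess_coeff_0 excess_coeff_high\<close>)
qed

text \<open>
  Below \<open>T\<close> the coefficients of positive index have the sign of \<open>k - r\<close> with
  \<open>r = R * \<mu> - 1 / (1 - \<mu>)\<close>, but \<open>r\<close> need not lie between 0 and \<open>T\<close>. It is therefore clamped to this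
  interval: from below because the coefficient at 0 is negative, from above because
  all coefficients beyond \<open>T\<close> are positive.
\<close>

lemma excess_coeff_sign_change:
  assumes "T \<ge> 1" "0 < \<mu>" "\<mu> < 1" "1 < R * \<mu>"
  obtains s where "s \<le> real T" "\<And>k. k \<noteq> T \<Longrightarrow> 0 \<le> (real k - s) * excess_coeff T \<mu> R k"
proof -
  define r where "r = R * \<mu> - 1 / (1 - \<mu>)"
  define s where "s = max 0 (min (real T) r)"
  have "0 \<le> (real k - s) * excess_coeff T \<mu> R k" if "k \<noteq> T" for k
  proof -
    consider "k = 0" | "1 \<le> k" "k < T" | "T < k" using \<open>k \<noteq> T\<close> by linarith
    then show ?thesis
    proof cases
      case 1
      have "excess_coeff T \<mu> R 0 \<le> 0"
        using assms by (simp add: excess_coeff_0 mult_le_0_iff)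
      then show ?thesis using 1 by (auto simp: s_def mult_le_0_iff)
    next
      case 2
      have "(1 - \<mu>) * (real k - R * \<mu>) + 1 = (1 - \<mu>) * (real k - r)"
        using assms by (simp add: r_def field_simps)
      then have eq: "(real k - s) * excess_coeff T \<mu> R k =
          \<mu> ^ (T - 1 - k) * (1 - \<mu>) * ((real k - s) * (real k - r))"
        using 2 by (simp add: excess_coeff_low)
      have "0 \<le> (real k - s) * (real k - r)"
        using 2 by (auto simp: s_def max_def min_def zero_le_mult_iff)
      moreover have "0 \<le> \<mu> ^ (T - 1 - k) * (1 - \<mu>)" using assms by simp
      ultimately show ?thesis unfolding eq by (rule mult_nonneg_nonneg[rotated])
    next
      case 3
      then show ?thesis by (auto simp: excess_coeff_high s_def)
    qed
  qed
  then show thesis by (intro that[of s]) (auto simp: s_def)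
qed

section \<open>Equilibria\<close>

lemma equilibrium_rate_0_iff:
  assumes "\<Lambda> \<ge> 1"
  shows "equilibrium_rate T \<mu> R \<Lambda> 0 \<longleftrightarrow> R \<le> sojourn T \<mu> 0"
proof -
  have "equilibrium_rate T \<mu> R \<Lambda> 0 \<longleftrightarrow> symmetric_nash T \<mu> R \<Lambda> 0"
    using assms by (auto simp: equilibrium_rate_def)
  also have "\<dots> \<longleftrightarrow> (\<forall>p\<in>{0..1}. p * (R - sojourn T \<mu> 0) \<le> 0)"
    by (simp add: symmetric_nash_def net_benefit_def)
  also have "\<dots> \<longleftrightarrow> R \<le> sojourn T \<mu> 0"
    by (auto simp: mult_le_0_iff dest: bspec[where x = 1])
  finally show ?thesis .
qed

text \<open>
  The net benefit is linear in the customer's own joining probability \<open>p\<close>. A positive rate below 1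
  forces \<open>0 < q < 1\<close> because \<open>\<Lambda> \<ge> 1\<close>, and an interior maximiser of a linear function exists only
  if the slope vanishes.
\<close>

lemma equilibrium_rate_pos_iff:
  assumes "\<Lambda> \<ge> 1"
  shows "0 < lam \<and> equilibrium_rate T \<mu> R \<Lambda> lam \<longleftrightarrow> 0 < lam \<and> lam < 1 \<and> sojourn T \<mu> lam = R"
proof
  assume A: "0 < lam \<and> equilibrium_rate T \<mu> R \<Lambda> lam"
  then obtain q where q: "symmetric_nash T \<mu> R \<Lambda> q" "lam = \<Lambda> * q"
    by (auto simp: equilibrium_rate_def)
  define D where "D = R - sojourn T \<mu> lam"
  have lt: "lam < 1" and best: "p * D \<le> q * D" if "p \<in> {0..1}" for p
    using q that by (auto simp: symmetric_nash_def net_benefit_def D_def)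
  have q01: "0 < q" "q < 1"
  proof -
    show "0 < q" using A q(2) assms by (simp add: zero_less_mult_iff)
    then have "q \<le> lam" using assms q(2) by (simp add: mult_le_cancel_right1)
    then show "q < 1" using lt[of 0] by simp
  qed
  have "0 \<le> q * D" "D \<le> q * D" using best[of 0] best[of 1] by auto
  then have "0 \<le> D" "(1 - q) * D \<le> 0" using q01 by (auto simp: zero_le_mult_iff algebra_simps)
  then have "D = 0" using q01 by (auto simp: mult_le_0_iff)
  then show "0 < lam \<and> lam < 1 \<and> sojourn T \<mu> lam = R" using A lt[of 0] by (simp add: D_def)
next
  assume A: "0 < lam \<and> lam < 1 \<and> sojourn T \<mu> lam = R"
  then have "symmetric_nash T \<mu> R \<Lambda> (lam / \<Lambda>)"
    using assms by (auto simp: symmetric_nash_def net_benefit_def)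
  then show "0 < lam \<and> equilibrium_rate T \<mu> R \<Lambda> lam"
    using A assms by (auto simp: equilibrium_rate_def intro!: exI[of _ "lam / \<Lambda>"])
qed

lemma equilibrium_rate_nonneg:
  assumes "\<Lambda> \<ge> 1" "equilibrium_rate T \<mu> R \<Lambda> lam"
  shows "0 \<le> lam"
  using assms by (auto simp: equilibrium_rate_def symmetric_nash_def)

lemma card_pos_equilibria_le:
  assumes "T \<ge> 1" "0 < \<mu>" "\<mu> < 1" "\<Lambda> \<ge> 1"
    and "\<And>k. 0 \<le> (\<Prod>s\<leftarrow>ss. real k - s) * excess_coeff T \<mu> R k"
    and "0 < (\<Prod>s\<leftarrow>ss. real m - s) * excess_coeff T \<mu> R m"
  shows "finite {lam. 0 < lam \<and> equilibrium_rate T \<mu> R \<Lambda> lam} \<and>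
    card {lam. 0 < lam \<and> equilibrium_rate T \<mu> R \<Lambda> lam} \<le> length ss"
proof -
  have "{lam. 0 < lam \<and> equilibrium_rate T \<mu> R \<Lambda> lam} =
      {x. 0 < x \<and> x < 1 \<and> (\<Sum>k. excess_coeff T \<mu> R k * x ^ k) = 0}"
    unfolding equilibrium_rate_pos_iff[OF assms(4)]
    by (intro Collect_cong conj_cong refl sojourn_eq_iff_excess_zero[OF assms(1-3)]) auto
  moreover have "summable (\<lambda>k. excess_coeff T \<mu> R k * x ^ k)" if "0 < x" "x < 1" for x
    using excess_coeff_sums[OF assms(1), of x \<mu> R] that by (auto intro: sums_summable)
  ultimately show ?thesis
    using card_zeros_power_series_le[OF _ assms(5,6)] by simp
qed

text \<open>
  The delay function has a pole at 1, so the intermediate value theorem is applied after multiplying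
  by the denominator, to a polynomial that is continuous up to 1.
\<close>

lemma ex_sojourn_eq:
  assumes T: "T \<ge> 1" and \<mu>: "0 < \<mu>" "\<mu> < 1" and R: "1 / \<mu> < R"
  shows "\<exists>x. 0 < x \<and> x < 1 \<and> sojourn T \<mu> x = R"
proof -
  define h where "h x = delay_num T \<mu> x - R * ((1 - x) * delay_den T \<mu> x)" for x
  have "sojourn T \<mu> 0 < R" using R sojourn_0[OF T \<mu>(1)] by simp
  then have h0: "h 0 < 0"
    using delay_den_pos[OF \<mu>, of 0 T] by (simp add: h_def sojourn_def field_simps)
  have h1: "h 1 = 1" by (simp add: h_def delay_num_eq_sum[OF T])
  have "continuous_on {0..1} h"
    unfolding h_def delay_num_def delay_den_def by (intro continuous_intros)
  then obtain x where x: "0 \<le> x" "x \<le> 1" "h x = 0"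
    using IVT'[of h 0 0 1] h0 h1 by auto
  then have "0 < x" "x < 1" using h0 h1 by (auto simp: order.order_iff_strict)
  then show ?thesis
    using x(3) delay_den_pos[OF \<mu>, of x T]
    by (intro exI[of _ x]) (auto simp: h_def sojourn_def field_simps)
qed

theorem theorem2:
  fixes T :: nat and \<mu> R \<Lambda> :: real
  assumes "T \<ge> 1" and "0 < \<mu>" and "\<mu> < 1" and "R \<ge> 0" and "\<Lambda> \<ge> 1"
  shows
    "(R < 1 \<longrightarrow> (\<forall>lam. equilibrium_rate T \<mu> R \<Lambda> lam \<longleftrightarrow> lam = 0)) \<and>
     (1 \<le> R \<and> R \<le> 1 / \<mu> \<longrightarrow>
        equilibrium_rate T \<mu> R \<Lambda> 0 \<and>
        finite {lam. 0 < lam \<and> equilibrium_rate T \<mu> R \<Lambda> lam} \<and>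
        card {lam. 0 < lam \<and> equilibrium_rate T \<mu> R \<Lambda> lam} \<le> 2) \<and>
     (R > 1 / \<mu> \<longrightarrow>
        finite {lam. 0 < lam \<and> equilibrium_rate T \<mu> R \<Lambda> lam} \<and>
        1 \<le> card {lam. 0 < lam \<and> equilibrium_rate T \<mu> R \<Lambda> lam} \<and>
        card {lam. 0 < lam \<and> equilibrium_rate T \<mu> R \<Lambda> lam} \<le> 3)"
proof -
  note hyps = assms(1-3)
  let ?E = "{lam. 0 < lam \<and> equilibrium_rate T \<mu> R \<Lambda> lam}"
  have zero: "equilibrium_rate T \<mu> R \<Lambda> 0" if "R \<le> 1 / \<mu>"
    using that equilibrium_rate_0_iff[OF assms(5)] sojourn_0[OF assms(1,2)] by simp
  have "1 < 1 / \<mu>" using assms(2,3) by simp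
  have i: "equilibrium_rate T \<mu> R \<Lambda> lam \<longleftrightarrow> lam = 0" if R: "R < 1" for lam
  proof -
    have R\<mu>: "R * \<mu> \<le> 1" "R * (1 - \<mu>) \<le> 1"
      using R assms by (auto intro: mult_le_one)
    have nonneg: "0 \<le> excess_coeff T \<mu> R k" for k
      using excess_coeff_nonneg[OF hyps R\<mu>(1)] excess_coeff_T[OF assms(1)] R\<mu>(2)
      by (cases "k = T") auto
    have "finite ?E \<and> card ?E \<le> length ([] :: real list)"
      using nonneg by (intro card_pos_equilibria_le[OF hyps assms(5), where m = "Suc T"])
        (auto simp: excess_coeff_high)
    then have "?E = {}" by auto
    then have "\<not> (0 < lam \<and> equilibrium_rate T \<mu> R \<Lambda> lam)" by blast
    moreover have "equilibrium_rate T \<mu> R \<Lambda> 0" using zero R \<open>1 < 1 / \<mu>\<close> by simp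
    ultimately show ?thesis
      using equilibrium_rate_nonneg[OF assms(5), of T \<mu> R lam] by (metis order_le_less)
  qed
  have ii: "finite ?E \<and> card ?E \<le> 2" if R: "R \<le> 1 / \<mu>"
  proof -
    have "R * \<mu> \<le> 1" using R assms(2) by (simp add: field_simps)
    then have nonneg: "0 \<le> (real k - real T)\<^sup>2 * excess_coeff T \<mu> R k" for k
      using excess_coeff_nonneg[OF hyps, of R k] by (cases "k = T") simp_all
    \<comment> \<open>The coefficient at \<open>T\<close> may have either sign. A double node there annihilates it and
      preserves the signs of all others.\<close>
    have "finite ?E \<and> card ?E \<le> length [real T, real T]"
    proof (rule card_pos_equilibria_le[OF hyps assms(5)])
      show "0 \<le> (\<Prod>s\<leftarrow>[real T, real T]. real k - s) * excess_coeff T \<mu> R k" for k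
        using nonneg[of k] by (simp add: power2_eq_square)
      show "0 < (\<Prod>s\<leftarrow>[real T, real T]. real (Suc T) - s) * excess_coeff T \<mu> R (Suc T)"
        by (simp add: excess_coeff_high)
    qed
    then show ?thesis by simp
  qed
  have iii: "finite ?E \<and> 1 \<le> card ?E \<and> card ?E \<le> 3" if R: "1 / \<mu> < R"
  proof -
    have "1 < R * \<mu>" using R assms(2) by (simp add: field_simps)
    then obtain s where s: "s \<le> real T" "\<And>k. k \<noteq> T \<Longrightarrow> 0 \<le> (real k - s) * excess_coeff T \<mu> R k"
      using excess_coeff_sign_change[OF hyps] by metis
    have nonneg: "0 \<le> (real k - real T)\<^sup>2 * ((real k - s) * excess_coeff T \<mu> R k)" for k
      using s(2)[of k] by (cases "k = T") auto
    have "finite ?E \<and> card ?E \<le> length [real T, real T, s]"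
    proof (rule card_pos_equilibria_le[OF hyps assms(5)])
      show "0 \<le> (\<Prod>s\<leftarrow>[real T, real T, s]. real k - s) * excess_coeff T \<mu> R k" for k
        using nonneg[of k] by (simp add: power2_eq_square mult.assoc)
      show "0 < (\<Prod>s\<leftarrow>[real T, real T, s]. real (Suc T) - s) * excess_coeff T \<mu> R (Suc T)"
        using s(1) by (simp add: excess_coeff_high)
    qed
    moreover have "?E \<noteq> {}"
      using ex_sojourn_eq[OF hyps R] equilibrium_rate_pos_iff[OF assms(5)] by blast
    ultimately show ?thesis by (auto simp: Suc_le_eq card_gt_0_iff)
  qed
  show ?thesis using i ii iii zero by blast
qed

end
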